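(* Let $\alpha\in(0,1)$ and let the coefficients $c_j$ ($j\ge0$) and $c_n^n$ ($n\ge1$) be defined from the sequence $a_n=\frac{(n+1)^\alpha-n^\alpha}{\Gamma(1+\alpha)}$, $n\ge0$, by $c_0=a_0^{(-1)}$, $c_i=-a_i^{(-1)}$ for $i\ge1$, and $c_n^n=c_0-\sum_{i=1}^{n-1}c_i$, where $a^{(-1)}$ is the convolution inverse of $a$. Then: (1) $c_i>0$ for all $i\ge0$ and $c_0=\sum_{i=1}^\infty c_i=\Gamma(1+\alpha)$. Consequently, $c_n^n=\sum_{i=n}^\infty c_i>0$ and $c_0=\sum_{i=1}^{n-1}c_i+c_n^n$ for all $n\ge1$. (2) The following asymptotics hold: $$c_j=\frac{-1}{\Gamma(-\alpha)}j^{-1-\alpha}(1+o(1)),\quad j\to\infty,\qquad c_n^n=\frac{n^{-\alpha}}{\Gamma(1-\alpha)}(1+o(1)),\quad n\to\infty.$$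
   Context: For sequences $p=(p_0,p_1,\ldots)$, $q=(q_0,q_1,\ldots)$ the convolution is $(p*q)_n=\sum_{m=0}^np_mq_{n-m}$. The convolution inverse $a^{(-1)}$ of $a$ is the sequence with $a*a^{(-1)}=(1,0,0,\ldots)$. *)

theory Defs
  imports "HOL-Analysis.Analysis" "HOL-Library.Landau_Symbols"
begin

definition seq_conv :: "(nat \<Rightarrow> real) \<Rightarrow> (nat \<Rightarrow> real) \<Rightarrow> nat \<Rightarrow> real" where
  "seq_conv p q n = (\<Sum>m=0..n. p m * q (n - m))"

definition conv_inverse :: "(nat \<Rightarrow> real) \<Rightarrow> nat \<Rightarrow> real" where
  "conv_inverse a = (THE b. seq_conv a b = (\<lambda>n. if n = 0 then 1 else 0))"

definition a_seq :: "real \<Rightarrow> nat \<Rightarrow> real" where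
  "a_seq \<alpha> n = (real (n + 1) powr \<alpha> - real n powr \<alpha>) / Gamma (1 + \<alpha>)"

definition c_coef :: "real \<Rightarrow> nat \<Rightarrow> real" where
  "c_coef \<alpha> i = (if i = 0 then conv_inverse (a_seq \<alpha>) 0 else - conv_inverse (a_seq \<alpha>) i)"

(* The coefficient written c_n^n in the mathematical text (the upper n is an index, not a power);
   meaningful for n >= 1. *)
definition c_diag :: "real \<Rightarrow> nat \<Rightarrow> real" where
  "c_diag \<alpha> n = c_coef \<alpha> 0 - (\<Sum>i=1..n-1. c_coef \<alpha> i)"

lemma seq_conv_fps: "seq_conv p q n = fps_nth (Abs_fps p * Abs_fps q) n"
  by (simp add: seq_conv_def fps_mult_nth)

lemma conv_inverse_ex1:
  assumes "a 0 \<noteq> 0"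
  shows "\<exists>!b. seq_conv a b = (\<lambda>n. if n = 0 then 1 else 0)"
proof -
  have iff: "seq_conv a b = (\<lambda>n. if n = 0 then 1 else 0) \<longleftrightarrow> Abs_fps a * Abs_fps b = 1" for b
    unfolding fun_eq_iff fps_eq_iff seq_conv_fps fps_one_nth by (rule refl)
  have inv: "Abs_fps a * inverse (Abs_fps a) = 1"
    using assms by (simp add: inverse_mult_eq_1')
  show ?thesis
  proof (intro ex1I)
    show "seq_conv a (fps_nth (inverse (Abs_fps a))) = (\<lambda>n. if n = 0 then 1 else 0)"
      unfolding iff using inv by (simp only: fps_nth_inverse)
  next
    fix b assume "seq_conv a b = (\<lambda>n. if n = 0 then 1 else 0)"
    then have "Abs_fps a * Abs_fps b = 1" by (simp only: iff)
    then have "Abs_fps b = inverse (Abs_fps a)"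
      by (rule fps_inverse_unique [symmetric])
    then have "fps_nth (Abs_fps b) = fps_nth (inverse (Abs_fps a))"
      by (rule arg_cong)
    then show "b = fps_nth (inverse (Abs_fps a))"
      by (simp only: Abs_fps_inverse mem_Collect_eq)
  qed
qed

lemma seq_conv_conv_inverse:
  assumes "a 0 \<noteq> 0"
  shows "seq_conv a (conv_inverse a) = (\<lambda>n. if n = 0 then 1 else 0)"
  unfolding conv_inverse_def by (rule theI' [OF conv_inverse_ex1 [of a, OF assms]])

lemma a_seq_0_nonzero:
  assumes "\<alpha> > 0"
  shows "a_seq \<alpha> 0 \<noteq> 0"
proof -
  have "Gamma (1 + \<alpha>) > 0" using assms by (intro Gamma_real_pos) simp
  then show ?thesis by (simp add: a_seq_def)
qed

end

theory Submission
  imports Defs "HOL-Real_Asymp.Real_Asymp"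
begin

text \<open>
  The sequence \<open>a\<close> is a Hausdorff moment sequence, since \<open>(n + u) powr (\<alpha> - 1)\<close> is, up to a constant,
  the Laplace transform of \<open>t powr (- \<alpha>)\<close> at \<open>n + u\<close>, and \<open>a n\<close> is its average over \<open>u\<close> in \<open>(0, 1)\<close>.
  Multiplication by the variable \<open>t\<close> on polynomials is then symmetric with spectrum in \<open>[0, 1]\<close>, and so
  is its compression to the orthogonal complement of 1. The coefficients \<open>c\<^sub>i\<close> with \<open>i \<ge> 1\<close> are
  moments of that compression, so they are nonnegative and decreasing.

  The generating function \<open>A\<close> of \<open>a\<close> and the generating function \<open>B\<close> of the tails \<open>c_diag\<close>
  satisfy \<open>A B = 1 / (1 - z)\<close>. As \<open>a\<close> is asymptotic to the coefficients of \<open>(1 - z) powr (- \<alpha>)\<close>, the series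
  \<open>A (1 - z) powr (\<alpha> - 1)\<close> has coefficients \<open>1 + o(1)\<close>, and multiplying by \<open>B\<close> gives the partial sums of
  \<open>c_diag\<close> up to a factor \<open>1 + o(1)\<close>. Monotonicity permits differentiating this asymptotic twice, first to
  \<open>c_diag\<close> and then to \<open>c\<close>.
\<close>

subsection \<open>Inverses of Hausdorff moment sequences\<close>

text \<open>The Riesz functional of \<open>a\<close>: the linear functional on polynomials sending
  \<open>x ^ i\<close> to \<open>a i\<close>. It stands for integration against a representing
  measure without constructing that measure.\<close>

definition moment :: "(nat \<Rightarrow> real) \<Rightarrow> real poly \<Rightarrow> real" where
  "moment a p = (\<Sum>i\<le>degree p. coeff p i * a i)"

lemma moment_eq_sum:
  assumes "degree p \<le> N"
  shows "moment a p = (\<Sum>i\<le>N. coeff p i * a i)"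
  unfolding moment_def using assms
  by (intro sum.mono_neutral_left) (auto simp: coeff_eq_0)

lemma moment_add: "moment a (p + q) = moment a p + moment a q"
proof -
  have "degree (p + q) \<le> max (degree p) (degree q)"
    by (rule degree_add_le_max)
  then show ?thesis
    by (simp add: moment_eq_sum[of _ "max (degree p) (degree q)"] distrib_right sum.distrib)
qed

lemma moment_smult: "moment a (smult c p) = c * moment a p"
  by (simp add: moment_eq_sum[of _ "degree p"] degree_smult_le sum_distrib_left mult.assoc)

lemma moment_diff: "moment a (p - q) = moment a p - moment a q"
  using moment_add[of a p "smult (-1) q"] moment_smult[of a "-1" q] by simp

lemma moment_0 [simp]: "moment a 0 = 0"
  by (simp add: moment_def)

lemma moment_const: "moment a [:c:] = c * a 0"
  by (simp add: moment_def)

lemma moment_monom: "moment a (monom c n) = c * a n"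
proof (cases "c = 0")
  case False
  then have "moment a (monom c n) = (\<Sum>i\<le>n. if n = i then c * a n else 0)"
    unfolding moment_def by (intro sum.cong) (auto simp: degree_monom_eq)
  then show ?thesis by simp
qed simp

lemma moment_sum: "moment a (\<Sum>i\<in>A. p i) = (\<Sum>i\<in>A. moment a (p i))"
  by (induction A rule: infinite_finite_induct) (auto simp: moment_add)

text \<open>This form of the Hausdorff condition turns inequalities between polynomials on [0, 1]
  directly into inequalities between moments.\<close>

locale hausdorff_moments =
  fixes a :: "nat \<Rightarrow> real"
  assumes a_0_pos: "a 0 > 0"
    and moment_nonneg: "(\<And>x. 0 \<le> x \<Longrightarrow> x \<le> 1 \<Longrightarrow> poly p x \<ge> 0) \<Longrightarrow> moment a p \<ge> 0"
begin

text \<open>For the inner product given by \<open>moment a (p * q)\<close>, \<open>return_poly n\<close> is obtained from 1 by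
  \<open>n\<close> multiplications with the variable, each followed by projection onto the orthogonal complement
  of 1; the coefficients removed are the first-return weights of the renewal equation for \<open>a\<close>.\<close>

primrec return_poly :: "nat \<Rightarrow> real poly" where
  "return_poly 0 = 1"
| "return_poly (Suc n) = pCons 0 (return_poly n) - [:moment a (pCons 0 (return_poly n)) / a 0:]"

definition return_coeff :: "nat \<Rightarrow> real" where
  "return_coeff n = moment a (pCons 0 (return_poly (n - 1))) / a 0"

lemma pCons_return_poly: "pCons 0 (return_poly n) = return_poly (Suc n) + [:return_coeff (Suc n):]"
  by (simp add: return_coeff_def)

declare return_poly.simps(2) [simp del]

lemma moment_return_poly_Suc [simp]: "moment a (return_poly (Suc n)) = 0"
  using a_0_pos by (simp add: return_poly.simps(2) moment_diff moment_const del: diff_pCons)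

text \<open>The constant split off at the \<open>k\<close>-th multiplication by the variable is
  carried along by the remaining \<open>n - k\<close> multiplications.\<close>

lemma monom_eq_return_poly:
  "monom 1 n = return_poly n + (\<Sum>k=1..n. monom (return_coeff k) (n - k))"
proof (induction n)
  case (Suc n)
  have "monom 1 (Suc n) = pCons 0 (monom 1 n :: real poly)"
    by (simp add: monom_Suc)
  also have "\<dots> = pCons 0 (return_poly n) + (\<Sum>k=1..n. pCons 0 (monom (return_coeff k) (n - k)))"
  proof -
    \<comment> \<open>Writing the shift as multiplication by an opaque \<open>X\<close> lets the
      distributive laws apply.\<close>
    define X :: "real poly" where "X = [:0, 1:]"
    have *: "pCons 0 p = X * p" for p by (simp add: X_def)
    show ?thesis unfolding * by (subst Suc) (simp only: distrib_left sum_distrib_left)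
  qed
  also have "(\<Sum>k=1..n. pCons 0 (monom (return_coeff k) (n - k))) = (\<Sum>k=1..n. monom (return_coeff k) (Suc n - k))"
    by (intro sum.cong) (auto simp: monom_Suc Suc_diff_le)
  finally show ?case
    by (simp add: pCons_return_poly monom_0)
qed simp

text \<open>Apply the functional to \<open>monom_eq_return_poly\<close>;
  \<open>return_poly n\<close> drops out, being orthogonal to 1.\<close>

lemma renewal_equation:
  assumes "n \<ge> 1"
  shows "a n = (\<Sum>k=1..n. return_coeff k * a (n - k))"
proof -
  obtain m where n: "n = Suc m" using assms by (cases n) auto
  have "a n = moment a (monom 1 n)" by (simp add: moment_monom)
  also have "\<dots> = (\<Sum>k=1..n. return_coeff k * a (n - k))"
    unfolding monom_eq_return_poly[of n] moment_add moment_sum moment_monom by (simp add: n)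
  finally show ?thesis .
qed

text \<open>The two first factors differ by a constant, which is orthogonal to
  \<open>return_poly (Suc j)\<close>.\<close>

lemma moment_return_poly_shift:
  "moment a (pCons 0 (return_poly i) * return_poly (Suc j)) = moment a (return_poly (Suc i) * return_poly (Suc j))"
  unfolding pCons_return_poly
  by (simp add: distrib_right moment_add moment_smult)

text \<open>Symmetry of the compression: multiplications move from the first factor to the second
  until \<open>return_poly (Suc 0)\<close> is left, where the definition of
  \<open>return_coeff\<close> applies.\<close>

lemma moment_return_poly_mult:
  "moment a (return_poly (Suc i) * return_poly (Suc j)) = a 0 * return_coeff (Suc i + Suc j)"
proof (induction i arbitrary: j)
  case 0
  show ?case
    unfolding moment_return_poly_shift[symmetric] using a_0_pos
    by (simp add: return_coeff_def)
next
  case (Suc i)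
  have "moment a (return_poly (Suc (Suc i)) * return_poly (Suc j)) =
    moment a (pCons 0 (return_poly (Suc i)) * return_poly (Suc j))"
    by (rule moment_return_poly_shift[symmetric])
  also have "pCons 0 (return_poly (Suc i)) * return_poly (Suc j) =
    pCons 0 (return_poly (Suc j)) * return_poly (Suc i)"
    by (simp add: mult.commute)
  also have "moment a \<dots> = moment a (return_poly (Suc i) * return_poly (Suc (Suc j)))"
    unfolding moment_return_poly_shift by (simp only: mult.commute)
  also have "\<dots> = a 0 * return_coeff (Suc (Suc i) + Suc j)"
    by (simp only: Suc.IH add_Suc add_Suc_right)
  finally show ?case .
qed

text \<open>Splitting the index evenly leaves one variable between two equal factors, hence
  \<open>x\<close> times a square; an even index gives a square. Both are nonnegative on
  [0, 1].\<close>

lemma return_coeff_odd: "a 0 * return_coeff (Suc (2 * i)) = moment a (pCons 0 (return_poly i * return_poly i))"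
proof (cases i)
  case 0
  then show ?thesis using a_0_pos by (simp add: return_coeff_def)
next
  case (Suc j)
  have "a 0 * return_coeff (Suc (2 * i)) = moment a (return_poly (Suc i) * return_poly (Suc j))"
    unfolding moment_return_poly_mult by (simp add: Suc mult_2)
  also have "\<dots> = moment a (pCons 0 (return_poly i) * return_poly (Suc j))"
    by (rule moment_return_poly_shift[symmetric])
  finally show ?thesis by (simp add: Suc)
qed

lemma return_coeff_even:
  "a 0 * return_coeff (Suc (Suc (2 * i))) = moment a (return_poly (Suc i) * return_poly (Suc i))"
  unfolding moment_return_poly_mult by (simp add: mult_2)

lemma moment_le:
  assumes "\<And>x. 0 \<le> x \<Longrightarrow> x \<le> 1 \<Longrightarrow> poly p x \<le> poly q x"
  shows "moment a p \<le> moment a q"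
  using moment_nonneg[of "q - p"] assms by (simp add: moment_diff)

lemma return_coeff_nonneg:
  assumes "n \<ge> 1"
  shows "return_coeff n \<ge> 0"
proof -
  have "a 0 * return_coeff n \<ge> 0"
  proof (cases "even n")
    case True
    then obtain m where "n = 2 * m" by blast
    with assms obtain i where "n = Suc (Suc (2 * i))" by (cases m) auto
    then show ?thesis by (auto simp: return_coeff_even intro!: moment_nonneg)
  next
    case False
    then obtain i where "n = Suc (2 * i)" by (metis oddE Suc_eq_plus1)
    then show ?thesis by (auto simp: return_coeff_odd intro!: moment_nonneg)
  qed
  then show ?thesis using a_0_pos by (simp add: zero_le_mult_iff)
qed

text \<open>From even to odd index, \<open>x * p^2 <= p^2\<close> on [0, 1]. From odd to even,
  projection does not increase the norm, and \<open>x^2 * p^2 <= x * p^2\<close>.\<close>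

lemma return_coeff_decreasing:
  assumes "n \<ge> 1"
  shows "return_coeff (Suc n) \<le> return_coeff n"
proof -
  have "a 0 * return_coeff (Suc n) \<le> a 0 * return_coeff n"
  proof (cases "even n")
    case True
    then obtain m where "n = 2 * m" by blast
    with assms obtain i where n: "n = Suc (Suc (2 * i))" by (cases m) auto
    have "moment a (pCons 0 (return_poly (Suc i) * return_poly (Suc i)))
      \<le> moment a (return_poly (Suc i) * return_poly (Suc i))"
      by (intro moment_le) (auto intro!: mult_left_le_one_le)
    then show ?thesis
      using return_coeff_odd[of "Suc i"] by (simp add: n return_coeff_even)
  next
    case False
    then obtain i where n: "n = Suc (2 * i)" by (metis oddE Suc_eq_plus1)
    let ?p = "return_poly i" and ?k = "return_coeff (Suc i)"
    have "moment a (return_poly (Suc i) * return_poly (Suc i)) =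
       moment a (pCons 0 ?p * return_poly (Suc i))"
      by (rule moment_return_poly_shift[symmetric])
    also have "\<dots> = moment a (pCons 0 ?p * (pCons 0 ?p - [:?k:]))"
      unfolding pCons_return_poly by simp
    also have "\<dots> = moment a (pCons 0 ?p * pCons 0 ?p) - ?k * moment a (pCons 0 ?p)"
      using moment_smult[of a ?k "pCons 0 ?p"]
      by (simp only: right_diff_distrib moment_diff) simp
    also have "moment a (pCons 0 ?p) = ?k * a 0"
      using a_0_pos by (simp add: return_coeff_def)
    \<comment> \<open>The discarded term is the squared norm of the projection of
      \<open>pCons 0 ?p\<close> onto 1.\<close>
    also have "moment a (pCons 0 ?p * pCons 0 ?p) - ?k * (?k * a 0) \<le> moment a (pCons 0 ?p * pCons 0 ?p)"
      using a_0_pos by (simp flip: mult.assoc)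
    also have "\<dots> \<le> moment a (pCons 0 (?p * ?p))"
    proof (intro moment_le)
      fix x :: real assume "0 \<le> x" "x \<le> 1"
      then have "x * (x * (poly ?p x * poly ?p x)) \<le> 1 * (x * (poly ?p x * poly ?p x))"
        by (intro mult_right_mono) auto
      then show "poly (pCons 0 ?p * pCons 0 ?p) x \<le> poly (pCons 0 (?p * ?p)) x"
        by (simp add: mult_ac)
    qed
    finally show ?thesis
      by (simp add: n return_coeff_even return_coeff_odd)
  qed
  then show ?thesis using a_0_pos by simp
qed

lemma a_decreasing: "m \<le> n \<Longrightarrow> a n \<le> a m"
  using moment_le[of "monom 1 n" "monom 1 m"]
  by (simp add: moment_monom poly_monom power_decreasing)

text \<open>The renewal equation, divided by \<open>a 0\<close>, is the defining convolution
  identity; uniqueness of the inverse does the rest.\<close>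

lemma conv_inverse_return_coeff:
  "conv_inverse a n = (if n = 0 then 1 / a 0 else - return_coeff n / a 0)"
proof -
  let ?b = "\<lambda>n. if n = 0 then 1 / a 0 else - return_coeff n / a 0"
  have "seq_conv a ?b n = (if n = 0 then 1 else 0)" for n
  proof (cases "n = 0")
    case True
    then show ?thesis using a_0_pos by (simp add: seq_conv_def)
  next
    case False
    have "seq_conv a ?b n = (\<Sum>m=0..n. ?b m * a (n - m))"
      unfolding seq_conv_def by (subst sum.atLeastAtMost_rev) (auto intro!: sum.cong simp: mult.commute)
    also have "\<dots> = a n / a 0 + (\<Sum>m=1..n. ?b m * a (n - m))"
      by (subst sum.atLeast_Suc_atMost) auto
    also have "(\<Sum>m=1..n. ?b m * a (n - m)) = - (\<Sum>m=1..n. return_coeff m * a (n - m)) / a 0"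
      unfolding sum_divide_distrib sum_negf[symmetric] by (intro sum.cong) auto
    also have "\<dots> = - a n / a 0"
      using renewal_equation[of n] False by simp
    finally show ?thesis using False by simp
  qed
  then have "seq_conv a ?b = (\<lambda>n. if n = 0 then 1 else 0)" by blast
  moreover have "seq_conv a (conv_inverse a) = (\<lambda>n. if n = 0 then 1 else 0)"
    using a_0_pos by (intro seq_conv_conv_inverse) simp
  ultimately have "conv_inverse a = ?b"
    using conv_inverse_ex1[of a] a_0_pos by (metis less_irrefl)
  then show ?thesis by simp
qed

text \<open>Each \<open>a (n - k)\<close> in the renewal equation is at least \<open>a n\<close>,
  which then cancels.\<close>

lemma sum_return_coeff_le_1:
  assumes "a n > 0"
  shows "(\<Sum>k=1..n. return_coeff k) \<le> 1"
proof (cases "n = 0")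
  case False
  have "(\<Sum>k=1..n. return_coeff k) * a n \<le> (\<Sum>k=1..n. return_coeff k * a (n - k))"
    unfolding sum_distrib_right
    by (intro sum_mono mult_left_mono a_decreasing return_coeff_nonneg) auto
  also have "\<dots> = 1 * a n" using renewal_equation[of n] False by simp
  finally show ?thesis using assms by (simp only: mult_le_cancel_right_pos)
qed simp

end

subsection \<open>The moment representation\<close>

text \<open>Substitution of \<open>k * t\<close> in Euler's integral.\<close>

lemma Gamma_integral_real_scaled:
  assumes "x > (0::real)" and "k > 0"
  shows "((\<lambda>t. t powr (x - 1) / exp (k * t)) has_integral Gamma x / k powr x) {0..}"
proof -
  let ?f = "\<lambda>t. t powr (x - 1) / exp t"
  have "(?f has_integral Gamma x) {0..}"
    using assms by (intro Gamma_integral_real)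
  then have f: "?f absolutely_integrable_on {0..}" "integral {0..} ?f = Gamma x"
    by (auto intro!: nonnegative_absolutely_integrable_1 simp: has_integral_iff)
  have "((*) k) ` {0..} = {0..}"
  proof (intro equalityI subsetI)
    fix t assume "t \<in> {0::real..}"
    then show "t \<in> (*) k ` {0..}"
      using assms by (intro image_eqI[of _ _ "t / k"]) auto
  qed (use assms in auto)
  then have "(\<lambda>t. \<bar>k\<bar> * ?f (k * t)) absolutely_integrable_on {0..} \<and>
    integral {0..} (\<lambda>t. \<bar>k\<bar> * ?f (k * t)) = Gamma x"
    using f assms
    by (subst has_absolute_integral_change_of_variables_1')
       (auto intro!: derivative_eq_intros inj_onI)
  then have "((\<lambda>t. \<bar>k\<bar> * ?f (k * t)) has_integral Gamma x) {0..}"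
    by (metis has_integral_iff set_lebesgue_integral_eq_integral(1))
  then have "((\<lambda>t. (1 / k powr x) * (\<bar>k\<bar> * ?f (k * t))) has_integral (1 / k powr x) * Gamma x) {0..}"
    by (rule has_integral_mult_right)
  then have "((\<lambda>t. t powr (x - 1) / exp (k * t)) has_integral (1 / k powr x) * Gamma x) {0..}"
  proof (rule has_integral_eq[rotated])
    fix t :: real assume "t \<in> {0..}"
    then have "(k * t) powr (x - 1) = k powr x / k * t powr (x - 1)"
      using assms by (simp add: powr_mult powr_diff)
    then show "(1 / k powr x) * (\<bar>k\<bar> * ?f (k * t)) = t powr (x - 1) / exp (k * t)"
      using assms by simp
  qed
  then show ?thesis by simp
qed

lemma moment_powr_nonneg:
  assumes "\<alpha> < 1" and "u > 0" and "\<And>x. 0 \<le> x \<Longrightarrow> x \<le> 1 \<Longrightarrow> poly p x \<ge> 0"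
  shows "moment (\<lambda>i. (real i + u) powr (\<alpha> - 1)) p \<ge> 0"
proof -
  let ?x = "1 - \<alpha>"
  have "((\<lambda>t. \<Sum>i\<le>degree p. coeff p i * (t powr (?x - 1) / exp ((real i + u) * t))) has_integral
    (\<Sum>i\<le>degree p. coeff p i * (Gamma ?x / (real i + u) powr ?x))) {0..}"
    using assms by (intro has_integral_sum has_integral_mult_right Gamma_integral_real_scaled) auto
  also have "(\<Sum>i\<le>degree p. coeff p i * (Gamma ?x / (real i + u) powr ?x)) =
    Gamma ?x * moment (\<lambda>i. (real i + u) powr (\<alpha> - 1)) p"
    unfolding moment_def sum_distrib_left
    using powr_minus_divide[of _ ?x] by (intro sum.cong) auto
  finally have "0 \<le> Gamma ?x * moment (\<lambda>i. (real i + u) powr (\<alpha> - 1)) p"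
  proof (rule has_integral_nonneg)
    fix t :: real assume "t \<in> {0..}"
    \<comment> \<open>The sum is the value of \<open>p\<close> at \<open>exp (- t)\<close>, a point
      of [0, 1], times a nonnegative weight.\<close>
    have "(\<Sum>i\<le>degree p. coeff p i * (t powr (?x - 1) / exp ((real i + u) * t))) =
      poly p (exp (- t)) * (t powr (?x - 1) * exp (- u * t))"
      unfolding poly_altdef sum_distrib_right
      by (intro sum.cong)
         (auto simp: exp_of_nat_mult[symmetric] exp_minus[symmetric] divide_inverse exp_add[symmetric] algebra_simps)
    also have "\<dots> \<ge> 0"
      using \<open>t \<in> {0..}\<close> by (intro mult_nonneg_nonneg assms) auto
    finally show "0 \<le> (\<Sum>i\<le>degree p. coeff p i * (t powr (?x - 1) / exp ((real i + u) * t)))" .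
  qed
  moreover have "Gamma ?x > 0"
    using assms by (intro Gamma_real_pos) simp
  ultimately show ?thesis
    by (simp add: zero_le_mult_iff)
qed

text \<open>The open interval keeps \<open>u\<close> positive, as \<open>moment_powr_nonneg\<close>
  demands. For \<open>i = 0\<close> and \<alpha> < 1 the primitive is not differentiable at 0, hence
  the interior form of the fundamental theorem.\<close>

lemma a_seq_has_integral:
  assumes "0 < \<alpha>"
  shows "((\<lambda>u. \<alpha> / Gamma (1 + \<alpha>) * (real i + u) powr (\<alpha> - 1)) has_integral a_seq \<alpha> i) {0<..<1}"
proof -
  have G: "Gamma (1 + \<alpha>) \<noteq> 0"
    using assms Gamma_real_pos[of "1 + \<alpha>"] by linarith
  let ?F = "\<lambda>u. (real i + u) powr \<alpha> / Gamma (1 + \<alpha>)"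
  have "((\<lambda>u. \<alpha> / Gamma (1 + \<alpha>) * (real i + u) powr (\<alpha> - 1)) has_integral ?F 1 - ?F 0) {0..1}"
  proof (rule fundamental_theorem_of_calculus_interior)
    show "continuous_on {0..1} ?F"
      using assms G by (auto intro!: continuous_intros continuous_on_powr')
    show "(?F has_vector_derivative \<alpha> / Gamma (1 + \<alpha>) * (real i + u) powr (\<alpha> - 1)) (at u)"
      if "u \<in> {0<..<1}" for u
      unfolding has_real_derivative_iff_has_vector_derivative[symmetric]
      using that assms G
      by (auto intro!: derivative_eq_intros simp: powr_diff)
  qed simp
  then show ?thesis
    unfolding has_integral_Icc_iff_Ioo by (simp add: a_seq_def diff_divide_distrib add_ac)
qed

lemma hausdorff_moments_a_seq:
  assumes "0 < \<alpha>" and "\<alpha> < 1"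
  shows "hausdorff_moments (a_seq \<alpha>)"
proof
  have G: "Gamma (1 + \<alpha>) > 0" using assms by (intro Gamma_real_pos) simp
  then show "a_seq \<alpha> 0 > 0" by (simp add: a_seq_def)
  fix p :: "real poly" assume p: "\<And>x. 0 \<le> x \<Longrightarrow> x \<le> 1 \<Longrightarrow> poly p x \<ge> 0"
  have "((\<lambda>u. \<Sum>i\<le>degree p. coeff p i * (\<alpha> / Gamma (1 + \<alpha>) * (real i + u) powr (\<alpha> - 1)))
    has_integral moment (a_seq \<alpha>) p) {0<..<1}"
    unfolding moment_def
    using assms by (intro has_integral_sum has_integral_mult_right a_seq_has_integral) auto
  then show "moment (a_seq \<alpha>) p \<ge> 0"
  proof (rule has_integral_nonneg)
    fix u :: real assume "u \<in> {0<..<1}"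
    have "(\<Sum>i\<le>degree p. coeff p i * (\<alpha> / Gamma (1 + \<alpha>) * (real i + u) powr (\<alpha> - 1))) =
      \<alpha> / Gamma (1 + \<alpha>) * moment (\<lambda>i. (real i + u) powr (\<alpha> - 1)) p"
      unfolding moment_def sum_distrib_left by (intro sum.cong) auto
    also have "\<dots> \<ge> 0"
      using \<open>u \<in> _\<close> G assms p by (intro mult_nonneg_nonneg moment_powr_nonneg) auto
    finally show "0 \<le> (\<Sum>i\<le>degree p. coeff p i * (\<alpha> / Gamma (1 + \<alpha>) * (real i + u) powr (\<alpha> - 1)))" .
  qed
qed

subsection \<open>Regularly varying sequences and convolutions\<close>

text \<open>The powers of \<open>n\<close> and \<open>Suc n\<close> are asymptotically equal. This
  serves to pass between \<open>c_diag \<alpha> n\<close> and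
  \<open>c_diag \<alpha> (Suc n)\<close>.\<close>

lemma tendsto_divide_powr_shift:
  fixes f :: "nat \<Rightarrow> real"
  assumes "(\<lambda>n. f (Suc n) / real n powr r) \<longlonglongrightarrow> L"
  shows "(\<lambda>n. f n / real n powr r) \<longlonglongrightarrow> L"
proof -
  have "(\<lambda>n. real n powr r / real (Suc n) powr r) \<longlonglongrightarrow> 1"
    by real_asymp
  with assms have "(\<lambda>n. (f (Suc n) / real n powr r) * (real n powr r / real (Suc n) powr r)) \<longlonglongrightarrow> L * 1"
    by (rule tendsto_mult)
  moreover have "\<forall>\<^sub>F n in sequentially. (f (Suc n) / real n powr r) * (real n powr r / real (Suc n) powr r)
      = f (Suc n) / real (Suc n) powr r"
    using eventually_gt_at_top[of 0] by eventually_elim simp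
  ultimately have "(\<lambda>n. f (Suc n) / real (Suc n) powr r) \<longlonglongrightarrow> L"
    by (simp only: tendsto_cong mult_1_right)
  then show ?thesis by (rule LIMSEQ_imp_Suc)
qed

lemma tendsto_0_of_divide_powr:
  fixes f :: "nat \<Rightarrow> real"
  assumes "(\<lambda>n. f n / real n powr r) \<longlonglongrightarrow> L" and "r < 0"
  shows "f \<longlonglongrightarrow> 0"
proof -
  have "(\<lambda>n. real n powr r) \<longlonglongrightarrow> 0"
    using assms(2) by real_asymp
  from tendsto_mult[OF assms(1) this]
  have "(\<lambda>n. f n / real n powr r * real n powr r) \<longlonglongrightarrow> 0"
    by simp
  moreover have "\<forall>\<^sub>F n in sequentially. f n / real n powr r * real n powr r = f n"
    using eventually_gt_at_top[of 0] by eventually_elim simp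
  ultimately show ?thesis by (simp only: tendsto_cong)
qed

section \<open>Monotone density for sequences\<close>

lemma decreasing_increment_bounds:
  fixes U b :: "nat \<Rightarrow> real"
  assumes "\<And>n. n \<ge> 1 \<Longrightarrow> U (Suc n) = U n + b n"
    and "\<And>n. n \<ge> 1 \<Longrightarrow> b (Suc n) \<le> b n"
    and "1 \<le> m" and "m \<le> n"
  shows "(real n - real m) * b n \<le> U n - U m" and "U n - U m \<le> (real n - real m) * b m"
proof -
  \<comment> \<open>The first conjunct supplies what the upper bound needs in the induction
    step.\<close>
  have "b n \<le> b m \<and> (real n - real m) * b n \<le> U n - U m \<and> U n - U m \<le> (real n - real m) * b m"
    using \<open>m \<le> n\<close>
  proof (induction n rule: dec_induct)
    case (step n)
    have b: "b (Suc n) \<le> b n" and U: "U (Suc n) = U n + b n"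
      using assms(1,2)[of n] step(1) \<open>1 \<le> m\<close> by auto
    have "(real (Suc n) - real m) * b (Suc n) \<le> (real (Suc n) - real m) * b n"
      using b step(1) by (intro mult_left_mono) auto
    with b U step show ?case by (simp add: algebra_simps)
  qed simp
  then show "(real n - real m) * b n \<le> U n - U m" and "U n - U m \<le> (real n - real m) * b m"
    by auto
qed

text \<open>As \<open>b\<close> decreases, \<open>b n\<close> lies between the slopes of
  \<open>U\<close> to the right and to the left of \<open>n\<close>. Slopes between \<open>n\<close>
  and about \<open>l * n\<close> converge after scaling, and their limits tend to
  \<open>C * r\<close> as \<open>l\<close> tends to 1.\<close>

lemma monotone_density:
  fixes U b :: "nat \<Rightarrow> real"
  assumes lim: "(\<lambda>n. U n / real n powr r) \<longlonglongrightarrow> C"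
    and U: "\<And>n. n \<ge> 1 \<Longrightarrow> U (Suc n) = U n + b n"
    and b: "\<And>n. n \<ge> 1 \<Longrightarrow> b (Suc n) \<le> b n"
  shows "(\<lambda>n. b n / real n powr (r - 1)) \<longlonglongrightarrow> C * r"
proof -
  \<comment> \<open>\<open>m l n\<close> is the integer stand-in for \<open>l * real n\<close>,
    \<open>Q l n\<close> the scaled slope of \<open>U\<close> between \<open>n\<close> and
    \<open>m l n\<close>, and \<open>q l\<close> its limit.\<close>
  define m where "m l n = nat \<lfloor>l * real n\<rfloor>" for l n
  define Q where "Q l n = (U (m l n) - U n) / ((real (m l n) - real n) * real n powr (r - 1))" for l n
  define q where "q l = C * ((l powr r - 1) / (l - 1))" for l
  have m: "l * real n - 1 \<le> real (m l n)" "real (m l n) \<le> l * real n" if "l > 0" for l n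
    using that unfolding m_def by simp_all
  have m_ratio: "(\<lambda>n. real (m l n) / real n) \<longlonglongrightarrow> l" if "l > 0" for l
  proof (rule real_tendsto_sandwich)
    show "\<forall>\<^sub>F n in sequentially. (l * real n - 1) / real n \<le> real (m l n) / real n"
      using m(1)[OF that] by (intro always_eventually allI divide_right_mono) auto
    show "\<forall>\<^sub>F n in sequentially. real (m l n) / real n \<le> (l * real n) / real n"
      using m(2)[OF that] by (intro always_eventually allI divide_right_mono) auto
    show "(\<lambda>n. (l * real n - 1) / real n) \<longlonglongrightarrow> l" "(\<lambda>n. (l * real n) / real n) \<longlonglongrightarrow> l"
      by real_asymp+
  qed
  have m_top: "filterlim (m l) at_top sequentially" if "l > 0" for l
  proof -
    have "filterlim (\<lambda>n. l * real n - 1) at_top sequentially"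
      using that by real_asymp
    then have "filterlim (\<lambda>n. real (m l n)) at_top sequentially"
      by (rule filterlim_at_top_mono) (use m(1)[OF that] in auto)
    then show ?thesis by (simp add: filterlim_sequentially_iff_filterlim_real)
  qed
  have m_pos: "\<forall>\<^sub>F n in sequentially. 0 < m l n" if "l > 0" for l
    using filterlim_iff[THEN iffD1, OF m_top[OF that]] eventually_gt_at_top by blast
  have Q: "Q l \<longlonglongrightarrow> q l" if "l > 0" "l \<noteq> 1" for l
  proof -
    have "(\<lambda>n. (U (m l n) / real (m l n) powr r * (real (m l n) / real n) powr r - U n / real n powr r)
      / (real (m l n) / real n - 1)) \<longlonglongrightarrow> (C * l powr r - C) / (l - 1)"
      using that lim filterlim_compose[OF lim m_top] m_ratio by (intro tendsto_intros) auto
    moreover have "\<forall>\<^sub>F n in sequentially. (U (m l n) / real (m l n) powr r * (real (m l n) / real n) powr r - U n / real n powr r)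
      / (real (m l n) / real n - 1) = Q l n"
      using eventually_gt_at_top[of 0] m_pos[OF that(1)]
    proof eventually_elim
      case (elim n)
      have "real (m l n) / real n - 1 = (real (m l n) - real n) / real n"
        using elim by (simp add: diff_divide_distrib)
      moreover have "U (m l n) / real (m l n) powr r * (real (m l n) / real n) powr r - U n / real n powr r
        = (U (m l n) - U n) / real n powr r"
        using elim by (simp add: powr_divide diff_divide_distrib)
      ultimately show ?case
        using elim unfolding Q_def by (simp add: powr_diff)
    qed
    ultimately show ?thesis
      by (simp add: tendsto_cong q_def right_diff_distrib)
  qed
  \<comment> \<open>\<open>q l\<close> is \<open>C\<close> times a difference quotient of
    \<open>l powr r\<close> at 1.\<close>
  have "((\<lambda>l. l powr r) has_real_derivative r) (at 1)"
    by (auto intro!: derivative_eq_intros)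
  then have "((\<lambda>l. (l powr r - 1) / (l - 1)) \<longlongrightarrow> r) (at 1)"
    by (simp add: has_field_derivative_iff)
  then have q: "(q \<longlongrightarrow> C * r) (at 1)"
    unfolding q_def by (intro tendsto_intros)
  show ?thesis
  proof (rule order_tendstoI)
    fix y assume y: "y < C * r"
    \<comment> \<open>With \<open>l > 1\<close> the slope to the right of \<open>n\<close> bounds
      \<open>b n\<close> from below.\<close>
    have "(q \<longlongrightarrow> C * r) (at_right 1)"
      using q by (rule tendsto_within_subset) auto
    then have "\<forall>\<^sub>F l in at_right 1. y < q l \<and> 1 < l"
      using y by (intro eventually_conj order_tendstoD(1) eventually_at_right_less)
    then obtain l where l: "y < q l" "1 < l"
      using eventually_happens'[OF trivial_limit_at_right_real] by blast
    have "\<forall>\<^sub>F n in sequentially. y < Q l n"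
      using Q[of l] l by (intro order_tendstoD(1)) auto
    moreover have "\<forall>\<^sub>F n in sequentially. 1 < real (m l n) / real n"
      using m_ratio[of l] l by (intro order_tendstoD(1)) auto
    ultimately show "\<forall>\<^sub>F n in sequentially. y < b n / real n powr (r - 1)"
      using eventually_gt_at_top[of 0]
    proof eventually_elim
      case (elim n)
      then have mn: "n < m l n" by (simp add: field_simps)
      have "U (m l n) - U n \<le> (real (m l n) - real n) * b n"
        using U b elim mn by (intro decreasing_increment_bounds(2)) auto
      then have "(U (m l n) - U n) / (real (m l n) - real n) \<le> b n"
        using mn by (simp add: divide_simps mult.commute)
      then have "Q l n \<le> b n / real n powr (r - 1)"
        unfolding Q_def divide_divide_eq_left[symmetric] by (intro divide_right_mono) auto
      with elim show ?case by simp
    qed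
  next
    fix y assume y: "y > C * r"
    \<comment> \<open>With \<open>l < 1\<close> the slope to the left bounds \<open>b n\<close> from
      above; \<open>m_pos\<close> keeps the left end in the range of the recurrence for
      \<open>U\<close>.\<close>
    have "(q \<longlongrightarrow> C * r) (at_left 1)"
      using q by (rule tendsto_within_subset) auto
    then have "\<forall>\<^sub>F l in at_left 1. y > q l \<and> l \<in> {0<..<1}"
      using y by (intro eventually_conj order_tendstoD(2) eventually_at_left_real) auto
    then obtain l where l: "y > q l" "0 < l" "l < 1"
      using eventually_happens'[OF trivial_limit_at_left_real] by fastforce
    have "\<forall>\<^sub>F n in sequentially. y > Q l n"
      using Q[of l] l by (intro order_tendstoD(2)) auto
    moreover have "\<forall>\<^sub>F n in sequentially. 1 > real (m l n) / real n"
      using m_ratio[of l] l by (intro order_tendstoD(2)) auto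
    ultimately show "\<forall>\<^sub>F n in sequentially. y > b n / real n powr (r - 1)"
      using m_pos[OF l(2)] eventually_gt_at_top[of 0]
    proof eventually_elim
      case (elim n)
      then have mn: "m l n < n" by (simp add: field_simps)
      have "(real n - real (m l n)) * b n \<le> U n - U (m l n)"
        using U b elim mn by (intro decreasing_increment_bounds(1)) auto
      then have "b n \<le> (U (m l n) - U n) / (real (m l n) - real n)"
        using mn by (simp add: divide_simps algebra_simps)
      then have "b n / real n powr (r - 1) \<le> Q l n"
        unfolding Q_def divide_divide_eq_left[symmetric] by (intro divide_right_mono) auto
      with elim show ?case by simp
    qed
  qed
qed

text \<open>A Toeplitz argument: a fixed initial segment is negligible against \<open>M\<close> by
  \<open>lim\<close>; beyond it \<open>\<epsilon>\<close> is small and \<open>bound\<close> controls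
  the rest.\<close>

lemma seq_conv_null:
  fixes v w \<epsilon> M :: "nat \<Rightarrow> real"
  assumes v: "\<And>n. v n \<ge> 0" and w: "\<And>n. w n \<ge> 0" and M: "\<And>n. M n > 0"
    and bound: "\<And>n. seq_conv v w n \<le> M n"
    and \<epsilon>: "\<epsilon> \<longlonglongrightarrow> 0"
    and lim: "\<And>k. (\<lambda>n. w (n - k) / M n) \<longlonglongrightarrow> 0"
  shows "(\<lambda>n. seq_conv (\<lambda>k. v k * \<epsilon> k) w n / M n) \<longlonglongrightarrow> 0"
proof (rule tendstoI)
  fix \<eta> :: real assume \<eta>: "\<eta> > 0"
  then have "\<forall>\<^sub>F k in sequentially. \<bar>\<epsilon> k\<bar> < \<eta> / 2"
    using tendstoD[OF \<epsilon>, of "\<eta> / 2"] by simp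
  then obtain K where K: "\<And>k. k \<ge> K \<Longrightarrow> \<bar>\<epsilon> k\<bar> < \<eta> / 2"
    by (auto simp: eventually_sequentially)
  have "(\<lambda>n. \<Sum>k<K. v k * \<bar>\<epsilon> k\<bar> * (w (n - k) / M n)) \<longlonglongrightarrow> (\<Sum>k<K. v k * \<bar>\<epsilon> k\<bar> * 0)"
    by (intro tendsto_intros lim)
  then have "(\<lambda>n. \<Sum>k<K. v k * \<bar>\<epsilon> k\<bar> * (w (n - k) / M n)) \<longlonglongrightarrow> 0" by simp
  then have "\<forall>\<^sub>F n in sequentially. (\<Sum>k<K. v k * \<bar>\<epsilon> k\<bar> * (w (n - k) / M n)) < \<eta> / 2"
    using \<eta> by (intro order_tendstoD(2)) auto
  then show "\<forall>\<^sub>F n in sequentially. dist (seq_conv (\<lambda>k. v k * \<epsilon> k) w n / M n) 0 < \<eta>"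
    using eventually_ge_at_top[of K]
  proof eventually_elim
    case (elim n)
    have "\<bar>seq_conv (\<lambda>k. v k * \<epsilon> k) w n\<bar> \<le> (\<Sum>k=0..n. \<bar>v k * \<epsilon> k * w (n - k)\<bar>)"
      unfolding seq_conv_def by (rule sum_abs)
    \<comment> \<open>The second summand is added below \<open>K\<close> as well, so that it sums to
      the full convolution.\<close>
    also have "\<dots> \<le> (\<Sum>k=0..n. (if k < K then v k * \<bar>\<epsilon> k\<bar> * w (n - k) else 0) + \<eta> / 2 * (v k * w (n - k)))"
    proof (intro sum_mono)
      fix k
      have "\<bar>\<epsilon> k\<bar> * (v k * w (n - k)) \<le> \<eta> / 2 * (v k * w (n - k))" if "\<not> k < K"
        using K[of k] that v w by (intro mult_right_mono) auto
      then show "\<bar>v k * \<epsilon> k * w (n - k)\<bar> \<le> (if k < K then v k * \<bar>\<epsilon> k\<bar> * w (n - k) else 0) + \<eta> / 2 * (v k * w (n - k))"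
        using v[of k] w[of "n - k"] \<eta> by (auto simp: abs_mult mult_ac)
    qed
    also have "\<dots> = (\<Sum>k=0..n. if k < K then v k * \<bar>\<epsilon> k\<bar> * w (n - k) else 0) + \<eta> / 2 * seq_conv v w n"
      by (simp only: sum.distrib sum_distrib_left seq_conv_def)
    also have "(\<Sum>k=0..n. if k < K then v k * \<bar>\<epsilon> k\<bar> * w (n - k) else 0) = (\<Sum>k<K. v k * \<bar>\<epsilon> k\<bar> * w (n - k))"
      using elim by (intro sum.mono_neutral_cong_right) auto
    also have "\<dots> = (\<Sum>k<K. v k * \<bar>\<epsilon> k\<bar> * (w (n - k) / M n)) * M n"
      using M[of n] unfolding sum_distrib_right by (intro sum.cong) auto
    also have "\<dots> + \<eta> / 2 * seq_conv v w n < \<eta> / 2 * M n + \<eta> / 2 * M n"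
      using elim M[of n] bound[of n] \<eta> by (intro add_less_le_mono mult_strict_right_mono mult_left_mono) auto
    finally show ?case using M[of n] by (simp add: divide_simps abs_if split: if_splits)
  qed
qed

text \<open>The coefficients of the power series of \<open>(1 - z) powr (- x)\<close>.\<close>

definition rising :: "real \<Rightarrow> nat \<Rightarrow> real" where
  "rising x n = pochhammer x n / fact n"

lemma rising_eq_gbinomial: "rising x n = (-1) ^ n * (- x gchoose n)"
  by (simp add: rising_def gbinomial_pochhammer flip: power_mult_distrib)

text \<open>Chu-Vandermonde, that is, multiplication of powers of \<open>1 - z\<close>.\<close>

lemma seq_conv_rising: "seq_conv (rising x) (rising y) n = rising (x + y) n"
proof -
  have "seq_conv (rising x) (rising y) n = (\<Sum>k=0..n. (-1) ^ n * ((- x gchoose k) * (- y gchoose (n - k))))"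
    unfolding seq_conv_def rising_eq_gbinomial
    by (intro sum.cong) (auto simp flip: power_add)
  also have "\<dots> = (-1) ^ n * (- x + - y gchoose n)"
    by (simp only: sum_distrib_left[symmetric] gbinomial_Vandermonde)
  finally show ?thesis by (simp add: rising_eq_gbinomial)
qed

lemma rising_1: "rising 1 n = 1"
  by (simp add: rising_def pochhammer_fact[symmetric])

lemma rising_pos: "x > 0 \<Longrightarrow> rising x n > 0"
  by (simp add: rising_def pochhammer_pos)

lemma rising_asymptotic:
  "(\<lambda>n. rising x n / real n powr (x - 1)) \<longlonglongrightarrow> inverse (Gamma x)"
proof -
  have "\<forall>\<^sub>F n in sequentially. (- x gchoose n) / ((-1) ^ n / exp ((- x + 1) * of_real (ln (real n)))) =
    rising x n / real n powr (x - 1)"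
    using eventually_gt_at_top[of 0]
    by eventually_elim (auto simp: rising_eq_gbinomial powr_def divide_simps exp_add[symmetric] algebra_simps)
  with gbinomial_asymptotic[of "- x"] show ?thesis
    by (simp add: tendsto_cong)
qed

subsection \<open>Asymptotics of the coefficients\<close>

lemma Gamma_real_plus1: "x > 0 \<Longrightarrow> Gamma (x + 1) = x * Gamma (x :: real)"
  by (rule Gamma_plus1) (auto elim!: nonpos_Ints_cases)

text \<open>Converts the limit constant to \<open>Gamma (- \<alpha>)\<close>; the point lies
  strictly between -1 and 0, so it is not a pole.\<close>

lemma Gamma_uminus_plus1:
  assumes "0 < \<alpha>" and "\<alpha> < (1::real)"
  shows "Gamma (1 - \<alpha>) = - \<alpha> * Gamma (- \<alpha>)"
proof -
  have "- \<alpha> \<notin> \<int>\<^sub>\<le>\<^sub>0"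
  proof
    assume "- \<alpha> \<in> \<int>\<^sub>\<le>\<^sub>0"
    then obtain k where "- \<alpha> = of_int k" by (auto elim!: nonpos_Ints_cases)
    with assms have "-1 < k" "k < 0" by linarith+
    then show False by simp
  qed
  from Gamma_plus1[OF this] show ?thesis by simp
qed

context
  fixes \<alpha> :: real
  assumes \<alpha>: "0 < \<alpha>" "\<alpha> < 1"
begin

interpretation hausdorff_moments "a_seq \<alpha>"
  using \<alpha> by (rule hausdorff_moments_a_seq)

lemma Gamma_1_plus_pos: "Gamma (1 + \<alpha>) > 0"
  using \<alpha> by (intro Gamma_real_pos) simp

lemma a_seq_pos: "a_seq \<alpha> n > 0"
  using \<alpha> Gamma_1_plus_pos by (simp add: a_seq_def powr_less_mono2)

lemma a_seq_asymptotic: "(\<lambda>n. a_seq \<alpha> n / real n powr (\<alpha> - 1)) \<longlonglongrightarrow> inverse (Gamma \<alpha>)"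
proof -
  have "(\<lambda>n. (real (n + 1) powr \<alpha> - real n powr \<alpha>) / real n powr (\<alpha> - 1)) \<longlonglongrightarrow> \<alpha>"
    using \<alpha> by real_asymp
  then have "(\<lambda>n. (real (n + 1) powr \<alpha> - real n powr \<alpha>) / real n powr (\<alpha> - 1) / Gamma (1 + \<alpha>))
     \<longlonglongrightarrow> \<alpha> / Gamma (1 + \<alpha>)"
    using Gamma_1_plus_pos by (intro tendsto_divide tendsto_const) auto
  also have "\<alpha> / Gamma (1 + \<alpha>) = inverse (Gamma \<alpha>)"
    using \<alpha> Gamma_real_plus1[of \<alpha>] by (simp add: add.commute[of 1] divide_simps)
  finally show ?thesis by (simp add: a_seq_def mult.commute)
qed

lemma a_seq_null: "a_seq \<alpha> \<longlonglongrightarrow> 0"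
  by (rule tendsto_0_of_divide_powr[OF a_seq_asymptotic]) (use \<alpha> in simp)

section \<open>Signs and monotonicity of the coefficients\<close>

lemma c_coef_0: "c_coef \<alpha> 0 = Gamma (1 + \<alpha>)"
  by (simp add: c_coef_def conv_inverse_return_coeff a_seq_def)

lemma c_coef_return_coeff: "i \<ge> 1 \<Longrightarrow> c_coef \<alpha> i = return_coeff i * Gamma (1 + \<alpha>)"
  by (simp add: c_coef_def conv_inverse_return_coeff a_seq_def)

lemma c_coef_nonneg: "c_coef \<alpha> i \<ge> 0"
  using Gamma_1_plus_pos
  by (cases "i = 0") (auto simp: c_coef_0 c_coef_return_coeff intro!: mult_nonneg_nonneg return_coeff_nonneg)

lemma c_coef_decreasing: "i \<ge> 1 \<Longrightarrow> c_coef \<alpha> (Suc i) \<le> c_coef \<alpha> i"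
  using Gamma_1_plus_pos
  by (auto simp: c_coef_return_coeff intro!: mult_right_mono return_coeff_decreasing)

lemma c_diag_Suc: "n \<ge> 1 \<Longrightarrow> c_diag \<alpha> (Suc n) = c_diag \<alpha> n - c_coef \<alpha> n"
  by (cases n) (auto simp: c_diag_def)

lemma c_diag_Suc_le: "n \<ge> 1 \<Longrightarrow> c_diag \<alpha> (Suc n) \<le> c_diag \<alpha> n"
  using c_coef_nonneg[of n] by (simp add: c_diag_Suc)

lemma c_diag_antimono:
  assumes "1 \<le> m" and "m \<le> n"
  shows "c_diag \<alpha> n \<le> c_diag \<alpha> m"
  using assms(2)
proof (induction n rule: dec_induct)
  case (step n)
  then show ?case using c_diag_Suc_le[of n] assms(1) by simp
qed simp

lemma c_diag_nonneg: "c_diag \<alpha> n \<ge> 0"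
proof -
  have "(\<Sum>i=1..n-1. c_coef \<alpha> i) = (\<Sum>i=1..n-1. return_coeff i) * Gamma (1 + \<alpha>)"
    unfolding sum_distrib_right by (intro sum.cong) (auto simp: c_coef_return_coeff)
  also have "\<dots> \<le> 1 * Gamma (1 + \<alpha>)"
    using Gamma_1_plus_pos by (intro mult_right_mono sum_return_coeff_le_1 a_seq_pos) auto
  finally show ?thesis by (simp add: c_diag_def c_coef_0)
qed

section \<open>Generating functions and partial sums of \<open>c_diag\<close>\<close>

lemma c_diag_Suc_eq_sum: "c_diag \<alpha> (Suc n) = (\<Sum>i=0..n. conv_inverse (a_seq \<alpha>) i)"
proof -
  have "(\<Sum>i=0..n. conv_inverse (a_seq \<alpha>) i) = c_coef \<alpha> 0 + (\<Sum>i=1..n. conv_inverse (a_seq \<alpha>) i)"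
    by (subst sum.atLeast_Suc_atMost) (auto simp: c_coef_def)
  also have "(\<Sum>i=1..n. conv_inverse (a_seq \<alpha>) i) = (\<Sum>i=1..n. - c_coef \<alpha> i)"
    by (intro sum.cong) (auto simp: c_coef_def)
  finally show ?thesis by (simp add: c_diag_def sum_negf)
qed

text \<open>Taking partial sums is multiplication by \<open>1 / (1 - z)\<close>, whose coefficients
  are \<open>rising 1\<close>. The shift makes \<open>c_diag \<alpha> 1\<close> the constant
  term.\<close>

lemma fps_a_seq_c_diag: "Abs_fps (a_seq \<alpha>) * Abs_fps (\<lambda>n. c_diag \<alpha> (Suc n)) = Abs_fps (rising 1)"
proof -
  let ?A = "Abs_fps (a_seq \<alpha>)" and ?F = "Abs_fps (conv_inverse (a_seq \<alpha>))"
  have "?A * ?F = 1"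
    using seq_conv_conv_inverse[of "a_seq \<alpha>"] a_seq_pos[of 0]
    by (simp add: fps_eq_iff fun_eq_iff seq_conv_fps)
  moreover have "Abs_fps (\<lambda>n. c_diag \<alpha> (Suc n)) = ?F * Abs_fps (rising 1)"
    by (simp add: fps_eq_iff fps_mult_nth c_diag_Suc_eq_sum rising_1)
  ultimately show ?thesis by (simp flip: mult.assoc)
qed

text \<open>The coefficients of \<open>A (1 - z) powr (\<alpha> - 1)\<close> minus those of
  \<open>1 / (1 - z)\<close>.\<close>

definition defect :: "nat \<Rightarrow> real" where
  "defect n = seq_conv (a_seq \<alpha>) (rising (1 - \<alpha>)) n - 1"

text \<open>With \<open>a_seq \<alpha>\<close> written as \<open>rising \<alpha>\<close> times
  \<open>1 + \<epsilon>\<close>, the main part convolves to exactly 1, and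
  \<open>seq_conv_null\<close> with scale 1 treats the error.\<close>

lemma defect_null: "defect \<longlonglongrightarrow> 0"
proof -
  define \<epsilon> where "\<epsilon> k = a_seq \<alpha> k / rising \<alpha> k - 1" for k
  have "(\<lambda>n. (a_seq \<alpha> n / real n powr (\<alpha> - 1)) / (rising \<alpha> n / real n powr (\<alpha> - 1)))
     \<longlonglongrightarrow> inverse (Gamma \<alpha>) / inverse (Gamma \<alpha>)"
    using \<alpha> by (intro tendsto_divide a_seq_asymptotic rising_asymptotic) (auto simp: Gamma_eq_zero_iff elim!: nonpos_Ints_cases)
  moreover have "\<forall>\<^sub>F n in sequentially. (a_seq \<alpha> n / real n powr (\<alpha> - 1)) / (rising \<alpha> n / real n powr (\<alpha> - 1)) = a_seq \<alpha> n / rising \<alpha> n"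
    using eventually_gt_at_top[of 0] by eventually_elim simp
  moreover have "inverse (Gamma \<alpha>) / inverse (Gamma \<alpha>) = 1"
    using \<alpha> by (auto simp: Gamma_eq_zero_iff elim!: nonpos_Ints_cases)
  ultimately have "(\<lambda>n. a_seq \<alpha> n / rising \<alpha> n) \<longlonglongrightarrow> 1"
    by (simp only: tendsto_cong)
  then have \<epsilon>: "\<epsilon> \<longlonglongrightarrow> 0"
    unfolding \<epsilon>_def using tendsto_diff[OF _ tendsto_const[of 1]] by fastforce
  have rising_null: "rising (1 - \<alpha>) \<longlonglongrightarrow> 0"
    by (rule tendsto_0_of_divide_powr[OF rising_asymptotic]) (use \<alpha> in simp)
  have "(\<lambda>n. seq_conv (\<lambda>k. rising \<alpha> k * \<epsilon> k) (rising (1 - \<alpha>)) n / 1) \<longlonglongrightarrow> 0"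
  proof (rule seq_conv_null)
    show "(\<lambda>n. rising (1 - \<alpha>) (n - k) / 1) \<longlonglongrightarrow> 0" for k
      using LIMSEQ_offset[of "\<lambda>n. rising (1 - \<alpha>) (n - k)" k] rising_null by simp
  qed (use \<alpha> \<epsilon> in \<open>auto simp: seq_conv_rising rising_1 intro!: less_imp_le rising_pos\<close>)
  moreover have "seq_conv (\<lambda>k. rising \<alpha> k * \<epsilon> k) (rising (1 - \<alpha>)) n = defect n" for n
  proof -
    have "rising \<alpha> k * \<epsilon> k = a_seq \<alpha> k - rising \<alpha> k" for k
      using rising_pos[of \<alpha> k] \<alpha> by (simp add: \<epsilon>_def right_diff_distrib)
    then have "seq_conv (\<lambda>k. rising \<alpha> k * \<epsilon> k) (rising (1 - \<alpha>)) n =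
      seq_conv (a_seq \<alpha>) (rising (1 - \<alpha>)) n - seq_conv (rising \<alpha>) (rising (1 - \<alpha>)) n"
      by (simp add: seq_conv_def left_diff_distrib sum_subtractf)
    then show ?thesis by (simp add: seq_conv_rising rising_1 defect_def)
  qed
  ultimately show ?thesis by simp
qed

text \<open>Multiply \<open>A B = 1 / (1 - z)\<close> by \<open>(1 - z) powr (\<alpha> - 1)\<close>
  and split off \<open>defect\<close>.\<close>

lemma sum_c_diag_eq:
  "(\<Sum>k=0..n. c_diag \<alpha> (Suc k)) = rising (2 - \<alpha>) n - seq_conv defect (\<lambda>n. c_diag \<alpha> (Suc n)) n"
proof -
  let ?A = "Abs_fps (a_seq \<alpha>)" and ?B = "Abs_fps (\<lambda>n. c_diag \<alpha> (Suc n))"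
    and ?P = "\<lambda>x. Abs_fps (rising x)"
  have P: "?P x * ?P y = ?P (x + y)" for x y
    by (simp add: fps_eq_iff seq_conv_fps[symmetric] seq_conv_rising)
  have "?A * ?P (1 - \<alpha>) = ?P 1 + Abs_fps defect"
    by (simp add: fps_eq_iff seq_conv_fps[symmetric] defect_def rising_1)
  then have "(?P 1 + Abs_fps defect) * ?B = (?A * ?B) * ?P (1 - \<alpha>)"
    by (simp add: mult_ac)
  also have "\<dots> = ?P (2 - \<alpha>)"
    unfolding fps_a_seq_c_diag P by simp
  finally have "fps_nth (?P 1 * ?B) n + fps_nth (Abs_fps defect * ?B) n = fps_nth (?P (2 - \<alpha>)) n"
    by (simp only: distrib_right fps_add_nth[symmetric])
  moreover have "fps_nth (?P 1 * ?B) n = fps_nth (?B * ?P 1) n"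
    by (simp only: mult.commute)
  ultimately show ?thesis
    by (simp add: seq_conv_fps[symmetric] seq_conv_def[of _ "rising 1"] rising_1)
qed

text \<open>As in \<open>sum_return_coeff_le_1\<close>, now for the coefficients of
  \<open>A B\<close>, all equal to 1. The bound has order \<open>n powr (1 - \<alpha>)\<close> and
  becomes the scale in \<open>seq_conv_null\<close>.\<close>

lemma sum_c_diag_bound: "(\<Sum>k=0..n. c_diag \<alpha> (Suc k)) \<le> 1 / a_seq \<alpha> n"
proof -
  have "(\<Sum>k=0..n. c_diag \<alpha> (Suc k)) * a_seq \<alpha> n \<le> (\<Sum>k=0..n. c_diag \<alpha> (Suc k) * a_seq \<alpha> (n - k))"
    unfolding sum_distrib_right
    by (intro sum_mono mult_left_mono a_decreasing c_diag_nonneg) auto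
  also have "\<dots> = fps_nth (Abs_fps (a_seq \<alpha>) * Abs_fps (\<lambda>n. c_diag \<alpha> (Suc n))) n"
    by (subst mult.commute) (simp add: fps_mult_nth)
  also have "\<dots> = 1"
    unfolding fps_a_seq_c_diag by (simp add: rising_1)
  finally show ?thesis using a_seq_pos[of n] by (simp add: divide_simps)
qed

lemma sum_c_diag_asymptotic:
  "(\<lambda>n. (\<Sum>k=0..n. c_diag \<alpha> (Suc k)) / real n powr (1 - \<alpha>)) \<longlonglongrightarrow> inverse (Gamma (2 - \<alpha>))"
proof -
  let ?d = "\<lambda>n. c_diag \<alpha> (Suc n)"
  have "(\<lambda>n. seq_conv (\<lambda>k. 1 * defect k) ?d n / (1 / a_seq \<alpha> n)) \<longlonglongrightarrow> 0"
  proof (rule seq_conv_null)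
    show "seq_conv (\<lambda>_. 1) ?d n \<le> 1 / a_seq \<alpha> n" for n
    proof -
      have "seq_conv (\<lambda>_. 1) ?d n = (\<Sum>k=0..n. ?d k)"
        unfolding seq_conv_def by (subst sum.atLeastAtMost_rev) auto
      with sum_c_diag_bound show ?thesis by simp
    qed
    show "(\<lambda>n. ?d (n - k) / (1 / a_seq \<alpha> n)) \<longlonglongrightarrow> 0" for k
    proof (rule tendsto_sandwich[OF _ _ tendsto_const])
      show "(\<lambda>n. ?d 0 * a_seq \<alpha> n) \<longlonglongrightarrow> 0"
        using tendsto_mult[OF tendsto_const a_seq_null] by simp
    qed (use less_imp_le[OF a_seq_pos] in
        \<open>auto intro!: always_eventually mult_nonneg_nonneg mult_right_mono c_diag_nonneg c_diag_antimono\<close>)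
  qed (auto intro: c_diag_nonneg a_seq_pos defect_null)
  then have "(\<lambda>n. seq_conv defect ?d n * a_seq \<alpha> n) \<longlonglongrightarrow> 0" by simp
  from tendsto_divide[OF this a_seq_asymptotic]
  have "(\<lambda>n. (seq_conv defect ?d n * a_seq \<alpha> n) / (a_seq \<alpha> n / real n powr (\<alpha> - 1))) \<longlonglongrightarrow> 0"
    using less_imp_neq[OF Gamma_real_pos[OF \<alpha>(1)]] by simp
  moreover have "(seq_conv defect ?d n * a_seq \<alpha> n) / (a_seq \<alpha> n / real n powr (\<alpha> - 1))
     = seq_conv defect ?d n / real n powr (1 - \<alpha>)" for n
    using a_seq_pos[of n] powr_minus_divide[of "real n" "1 - \<alpha>"] by simp
  ultimately have "(\<lambda>n. seq_conv defect ?d n / real n powr (1 - \<alpha>)) \<longlonglongrightarrow> 0"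
    by simp
  from tendsto_diff[OF rising_asymptotic[of "2 - \<alpha>"] this] show ?thesis
    unfolding sum_c_diag_eq diff_divide_distrib by simp
qed

lemma c_diag_asymptotic: "(\<lambda>n. c_diag \<alpha> n / real n powr (- \<alpha>)) \<longlonglongrightarrow> 1 / Gamma (1 - \<alpha>)"
proof (rule tendsto_divide_powr_shift)
  \<comment> \<open>Summing over \<open>k < n\<close> makes the increment at \<open>n\<close> equal
    to \<open>c_diag \<alpha> (Suc n)\<close>, as \<open>monotone_density\<close> requires.\<close>
  let ?U = "\<lambda>n. \<Sum>k<n. c_diag \<alpha> (Suc k)"
  have "(\<lambda>n. ?U (Suc n) / real n powr (1 - \<alpha>)) \<longlonglongrightarrow> inverse (Gamma (2 - \<alpha>))"
    using sum_c_diag_asymptotic by (simp only: lessThan_Suc_atMost atLeast0AtMost)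
  then have "(\<lambda>n. ?U n / real n powr (1 - \<alpha>)) \<longlonglongrightarrow> inverse (Gamma (2 - \<alpha>))"
    by (rule tendsto_divide_powr_shift)
  then have "(\<lambda>n. c_diag \<alpha> (Suc n) / real n powr (1 - \<alpha> - 1)) \<longlonglongrightarrow> inverse (Gamma (2 - \<alpha>)) * (1 - \<alpha>)"
    by (rule monotone_density) (auto intro: c_diag_Suc_le)
  moreover have "Gamma (2 - \<alpha>) = (1 - \<alpha>) * Gamma (1 - \<alpha>)"
    using Gamma_real_plus1[of "1 - \<alpha>"] \<alpha> by simp
  ultimately show "(\<lambda>n. c_diag \<alpha> (Suc n) / real n powr - \<alpha>) \<longlonglongrightarrow> 1 / Gamma (1 - \<alpha>)"
    using \<alpha> by (simp add: inverse_eq_divide)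
qed

lemma c_diag_null: "c_diag \<alpha> \<longlonglongrightarrow> 0"
  by (rule tendsto_0_of_divide_powr[OF c_diag_asymptotic]) (use \<alpha> in simp)

lemma c_coef_asymptotic:
  "(\<lambda>n. c_coef \<alpha> n / real n powr (- 1 - \<alpha>)) \<longlonglongrightarrow> \<alpha> / Gamma (1 - \<alpha>)"
proof -
  \<comment> \<open>The negated \<open>c_diag\<close> has increments \<open>c_coef\<close>; the
    exponent \<open>- \<alpha>\<close> cancels the sign.\<close>
  have "(\<lambda>n. - c_diag \<alpha> n / real n powr (- \<alpha>)) \<longlonglongrightarrow> - (1 / Gamma (1 - \<alpha>))"
    using tendsto_minus[OF c_diag_asymptotic] by simp
  then have "(\<lambda>n. c_coef \<alpha> n / real n powr (- \<alpha> - 1)) \<longlonglongrightarrow> - (1 / Gamma (1 - \<alpha>)) * (- \<alpha>)"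
    by (rule monotone_density) (auto simp: c_diag_Suc intro: c_coef_decreasing)
  moreover have "- \<alpha> - 1 = - 1 - \<alpha>" by simp
  ultimately show ?thesis by simp
qed

section \<open>Tail sums and strict positivity\<close>

lemma c_coef_sums:
  assumes "n \<ge> 1"
  shows "(\<lambda>i. c_coef \<alpha> (i + n)) sums c_diag \<alpha> n"
proof -
  have "(\<lambda>i. c_diag \<alpha> (i + n)) \<longlonglongrightarrow> 0"
    using c_diag_null by (rule LIMSEQ_ignore_initial_segment)
  from telescope_sums'[OF this] show ?thesis
    using assms by (simp add: c_diag_Suc)
qed

text \<open>The positive limit makes \<open>c_diag\<close> positive at some
  \<open>k \<ge> n\<close>; monotonicity carries this back to \<open>n\<close>.\<close>

lemma c_diag_pos:
  assumes "n \<ge> 1"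
  shows "c_diag \<alpha> n > 0"
proof -
  have "1 / Gamma (1 - \<alpha>) > 0"
    using \<alpha> by simp
  then have "\<forall>\<^sub>F k in sequentially. c_diag \<alpha> k / real k powr (- \<alpha>) > 0"
    by (rule order_tendstoD(1)[OF c_diag_asymptotic])
  then have "\<forall>\<^sub>F k in sequentially. c_diag \<alpha> k / real k powr (- \<alpha>) > 0 \<and> k \<ge> n"
    by (intro eventually_conj eventually_ge_at_top)
  then obtain k where "k \<ge> n" "c_diag \<alpha> k / real k powr (- \<alpha>) > 0"
    using eventually_happens'[OF sequentially_bot] by blast
  then show ?thesis
    using c_diag_antimono[of n k] assms by (auto simp: zero_less_divide_iff)
qed

text \<open>A vanishing coefficient of positive index would force all later ones to vanish, and with
  them the tail \<open>c_diag \<alpha> i\<close>.\<close>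

lemma c_coef_pos: "c_coef \<alpha> i > 0"
proof (rule ccontr)
  assume "\<not> c_coef \<alpha> i > 0"
  then have 0: "c_coef \<alpha> i = 0"
    using c_coef_nonneg[of i] by simp
  then have "i \<noteq> 0"
    using c_coef_0 Gamma_1_plus_pos by (intro notI) simp
  then have i: "i \<ge> 1" by simp
  have "c_coef \<alpha> (k + i) = 0" for k
  proof (induction k)
    case (Suc k)
    then show ?case
      using c_coef_decreasing[of "k + i"] c_coef_nonneg[of "Suc k + i"] i by simp
  qed (use 0 in simp)
  then have "c_diag \<alpha> i = 0"
    using c_coef_sums[OF i] sums_unique2[OF sums_zero] by simp
  with c_diag_pos[OF i] show False by simp
qed

end

theorem proposition3p1:
  fixes \<alpha> :: real
  assumes "0 < \<alpha>" and "\<alpha> < 1"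
  shows "(\<forall>i. c_coef \<alpha> i > 0)
    \<and> c_coef \<alpha> 0 = Gamma (1 + \<alpha>)
    \<and> (\<lambda>i. c_coef \<alpha> (i + 1)) sums Gamma (1 + \<alpha>)
    \<and> (\<forall>n\<ge>1. (\<lambda>i. c_coef \<alpha> (i + n)) sums c_diag \<alpha> n
            \<and> c_diag \<alpha> n > 0
            \<and> c_coef \<alpha> 0 = (\<Sum>i=1..n-1. c_coef \<alpha> i) + c_diag \<alpha> n)
    \<and> (\<lambda>j. c_coef \<alpha> j) \<sim>[at_top] (\<lambda>j. (-1) / Gamma (- \<alpha>) * real j powr (- 1 - \<alpha>))
    \<and> (\<lambda>n. c_diag \<alpha> n) \<sim>[at_top] (\<lambda>n. real n powr (- \<alpha>) / Gamma (1 - \<alpha>))"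
proof (intro conjI allI impI)
  show "c_coef \<alpha> i > 0" for i
    using assms by (rule c_coef_pos)
  show c0: "c_coef \<alpha> 0 = Gamma (1 + \<alpha>)"
    using assms by (rule c_coef_0)
  \<comment> \<open>At index 1 the sum in \<open>c_diag\<close> is empty, leaving
    \<open>c_coef \<alpha> 0\<close>.\<close>
  show "(\<lambda>i. c_coef \<alpha> (i + 1)) sums Gamma (1 + \<alpha>)"
    using c_coef_sums[OF assms, of 1] by (simp add: c_diag_def c0)
  fix n :: nat assume "n \<ge> 1"
  then show "(\<lambda>i. c_coef \<alpha> (i + n)) sums c_diag \<alpha> n" "c_diag \<alpha> n > 0"
    using assms by (auto intro: c_coef_sums c_diag_pos)
  show "c_coef \<alpha> 0 = (\<Sum>i=1..n-1. c_coef \<alpha> i) + c_diag \<alpha> n"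
    by (simp add: c_diag_def)
next
  have G: "Gamma (1 - \<alpha>) \<noteq> 0"
    using assms Gamma_real_pos[of "1 - \<alpha>"] by linarith
  have "\<alpha> / Gamma (1 - \<alpha>) = (-1) / Gamma (- \<alpha>)"
    using G assms Gamma_uminus_plus1[of \<alpha>] by (auto simp: divide_simps)
  with c_coef_asymptotic[OF assms] G assms
  show "(\<lambda>j. c_coef \<alpha> j) \<sim>[at_top] (\<lambda>j. (-1) / Gamma (- \<alpha>) * real j powr (- 1 - \<alpha>))"
    by (intro asymp_equivI'_const) auto
  have "(\<lambda>n. c_diag \<alpha> n) \<sim>[at_top] (\<lambda>n. 1 / Gamma (1 - \<alpha>) * real n powr (- \<alpha>))"
    using c_diag_asymptotic[OF assms] G by (intro asymp_equivI'_const) auto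
  then show "(\<lambda>n. c_diag \<alpha> n) \<sim>[at_top] (\<lambda>n. real n powr (- \<alpha>) / Gamma (1 - \<alpha>))"
    by simp
qed

end
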